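(* Let $\mathcal G=(G_n,\|\cdot\|_n)_{n\in\mathbb N}$ be a family of metric groups with $\|\cdot\|_n\le1$ for all $n$, and suppose the family of groups $(G_n)_{n\in\mathbb N}$ has the $(\star)$-property. Let $\mathcal U$ be a non-principal ultrafilter on $\mathbb N$. If the metric ultraproduct $\mathcal G^*_{\mathrm{met}}$ with respect to $\mathcal U$ is simple, then $\mathcal G^*_{\mathrm{met}}$ is metrically uniformly simple.
   Context: A metric group $(G,\|\cdot\|)$ is a group with a bi-invariant norm: $\|e\|=0$, $\|gh\|\le\|g\|+\|h\|$, $\|g^{-1}\|=\|g\|=\|hgh^{-1}\|$, and $\|g\|=0$ iff $g=e$. The metric ultraproduct is $\mathcal G^*_{\mathrm{met}}=\prod_{n}G_n/\mathcal E$, $\mathcal E=\{(g_n) : \lim_{n\to\mathcal U}\|g_n\|_n=0\}$, with norm $\|(g_n)/\mathcal E\|=\lim_{n\to\mathcal U}\|g_n\|_n$. $C_N(g,G)$ is the set of all products of at most $N$ conjugates (in $G$) of $g$ and $g^{-1}$, and $N(g,G)=\min\{n\in\mathbb N : C_n(g,G)=G\}$ (with value $\infty$ if there is no such $n$). A family of groups $\mathcal G$ has the $(\star)$-property if: (1) there is $N\in\mathbb N$ such that for any $G\in\mathcal G$ there is $g\in G$ with $C_N(g,G)=G$; and (2) for any $k\in\mathbb N$ there is $l\in\mathbb N$ such that for any $G\in\mathcal G$ and $g,h\in G$, if $N(g,G),N(h,G)\ge l$ then $N(gh,G)\ge k$. A group with (pseudo-)norm $(G,\|\cdot\|)$ is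 metrically uniformly simple if for all $t>r>0$ there is $N\in\mathbb N$ such that $C_N(g,G)\supseteq\{h\in G : \|h\|<t\}$ for all $g\in G$ with $\|g\|\in(r,t]$. *)

theory Defs
  imports "HOL-Analysis.Elementary_Topology" "HOL-Library.Extended_Nat" "HOL-Algebra.Product_Groups"
begin

text \<open>Non-negativity of the norm is not an axiom: it follows from
  \<open>0 = nrm \<one> \<le> nrm g + nrm (inv g) = 2 * nrm g\<close>.\<close>

locale metric_group = group G for G (structure) +
  fixes nrm :: "'a \<Rightarrow> real"
  assumes nrm_mult: "\<lbrakk>g \<in> carrier G; h \<in> carrier G\<rbrakk> \<Longrightarrow> nrm (g \<otimes> h) \<le> nrm g + nrm h"
    and nrm_inv: "g \<in> carrier G \<Longrightarrow> nrm (inv g) = nrm g"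
    and nrm_conj: "\<lbrakk>g \<in> carrier G; h \<in> carrier G\<rbrakk> \<Longrightarrow> nrm (h \<otimes> g \<otimes> inv h) = nrm g"
    and nrm_eq_0_iff: "g \<in> carrier G \<Longrightarrow> nrm g = 0 \<longleftrightarrow> g = \<one>"

text \<open>The locale \<open>simple_group\<close> of HOL-Algebra requires \<open>order G > 1\<close> with \<open>order G\<close> a natural
  number, which excludes infinite groups (their \<open>order\<close> is \<open>0\<close>).\<close>

definition simple_grp :: "('a, 'b) monoid_scheme \<Rightarrow> bool" where
  "simple_grp G \<longleftrightarrow> group G \<and> carrier G \<noteq> {\<one>\<^bsub>G\<^esub>} \<and>
     (\<forall>H. H \<lhd> G \<longrightarrow> H = carrier G \<or> H = {\<one>\<^bsub>G\<^esub>})"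

text \<open>The empty product is included, so \<open>\<one> \<in> conj_prods N g G\<close> for every \<open>N\<close>.\<close>

definition conj_prods :: "nat \<Rightarrow> 'a \<Rightarrow> ('a, 'b) monoid_scheme \<Rightarrow> 'a set" where
  "conj_prods N g G = {foldr (\<otimes>\<^bsub>G\<^esub>) xs \<one>\<^bsub>G\<^esub> | xs. length xs \<le> N \<and>
     set xs \<subseteq> {h \<otimes>\<^bsub>G\<^esub> x \<otimes>\<^bsub>G\<^esub> inv\<^bsub>G\<^esub> h | h x. h \<in> carrier G \<and> x \<in> {g, inv\<^bsub>G\<^esub> g}}}"

text \<open>In \<^typ>\<open>enat\<close>, the infimum of the empty set is \<open>\<infinity>\<close>, and the infimum of a nonempty set is
  its minimum.\<close>

definition conj_width :: "'a \<Rightarrow> ('a, 'b) monoid_scheme \<Rightarrow> enat" where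
  "conj_width g G = Inf {enat n | n. conj_prods n g G = carrier G}"

definition star_property :: "('a, 'b) monoid_scheme set \<Rightarrow> bool" where
  "star_property \<G> \<longleftrightarrow>
     (\<exists>N. \<forall>G\<in>\<G>. \<exists>g\<in>carrier G. conj_prods N g G = carrier G) \<and>
     (\<forall>k::nat. \<exists>l::nat. \<forall>G\<in>\<G>. \<forall>g\<in>carrier G. \<forall>h\<in>carrier G.
        conj_width g G \<ge> enat l \<and> conj_width h G \<ge> enat l \<longrightarrow>
        conj_width (g \<otimes>\<^bsub>G\<^esub> h) G \<ge> enat k)"

definition metrically_uniformly_simple :: "('a, 'b) monoid_scheme \<Rightarrow> ('a \<Rightarrow> real) \<Rightarrow> bool" where
  "metrically_uniformly_simple G nrm \<longleftrightarrow>
     (\<forall>r t. 0 < r \<and> r < t \<longrightarrow>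
        (\<exists>N. \<forall>g\<in>carrier G. nrm g \<in> {r<..t} \<longrightarrow>
           {h \<in> carrier G. nrm h < t} \<subseteq> conj_prods N g G))"

text \<open>An ultrafilter is represented as a HOL filter; its members are the sets \<open>A\<close> with
  \<open>\<forall>\<^sub>F n in U. n \<in> A\<close>.\<close>

definition ultrafilter :: "'i filter \<Rightarrow> bool" where
  "ultrafilter U \<longleftrightarrow> U \<noteq> bot \<and> (\<forall>P. (\<forall>\<^sub>F n in U. P n) \<or> (\<forall>\<^sub>F n in U. \<not> P n))"

definition nonprincipal :: "'i filter \<Rightarrow> bool" where
  "nonprincipal U \<longleftrightarrow> (\<forall>n. \<not> (\<forall>\<^sub>F m in U. m = n))"

definition met_null ::
  "nat filter \<Rightarrow> (nat \<Rightarrow> ('a, 'b) monoid_scheme) \<Rightarrow> (nat \<Rightarrow> 'a \<Rightarrow> real) \<Rightarrow> (nat \<Rightarrow> 'a) set" where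
  "met_null U G nrm =
     {g \<in> carrier (product_group UNIV G). ((\<lambda>n. nrm n (g n)) \<longlongrightarrow> 0) U}"

definition met_ultraproduct ::
  "nat filter \<Rightarrow> (nat \<Rightarrow> ('a, 'b) monoid_scheme) \<Rightarrow> (nat \<Rightarrow> 'a \<Rightarrow> real) \<Rightarrow> (nat \<Rightarrow> 'a) set monoid" where
  "met_ultraproduct U G nrm = product_group UNIV G Mod met_null U G nrm"

text \<open>The norm of a coset is the common limit of the norms of its representatives; it exists
  and is unique by \<open>tendsto_ultra_norm\<close> below.\<close>

definition ultra_norm :: "nat filter \<Rightarrow> (nat \<Rightarrow> 'a \<Rightarrow> real) \<Rightarrow> (nat \<Rightarrow> 'a) set \<Rightarrow> real" where
  "ultra_norm U nrm X = (THE r. \<forall>g\<in>X. ((\<lambda>n. nrm n (g n)) \<longlongrightarrow> r) U)"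

lemma (in metric_group) nrm_one: "nrm \<one> = 0"
  by (simp add: nrm_eq_0_iff)

lemma (in metric_group) nrm_nonneg: "g \<in> carrier G \<Longrightarrow> 0 \<le> nrm g"
  using nrm_mult[of g "inv g"] nrm_inv[of g] nrm_one by simp

lemma ultrafilter_convergent:
  fixes f :: "'i \<Rightarrow> real"
  assumes U: "ultrafilter U" and f: "\<And>n. a \<le> f n" "\<And>n. f n \<le> b"
  shows "\<exists>l. (f \<longlongrightarrow> l) U"
proof -
  have "filtermap f U \<noteq> bot"
    using U by (simp add: ultrafilter_def filtermap_bot_iff)
  moreover have "eventually (\<lambda>x. x \<in> {a..b}) (filtermap f U)"
    using f by (simp add: eventually_filtermap)
  moreover have "compact {a..b}" by (rule compact_Icc)
  ultimately obtain l where l: "inf (nhds l) (filtermap f U) \<noteq> bot"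
    unfolding compact_filter by blast
  have "(f \<longlongrightarrow> l) U"
  proof (rule topological_tendstoI)
    fix S assume S: "open S" "l \<in> S"
    show "\<forall>\<^sub>F n in U. f n \<in> S"
    proof (rule ccontr)
      assume "\<not> (\<forall>\<^sub>F n in U. f n \<in> S)"
      then have "\<forall>\<^sub>F n in U. f n \<notin> S"
        using U unfolding ultrafilter_def by blast
      then have "\<forall>\<^sub>F x in filtermap f U. x \<notin> S" by (simp add: eventually_filtermap)
      moreover have "\<forall>\<^sub>F x in nhds l. x \<in> S" using S by (auto simp: eventually_nhds)
      ultimately have "\<forall>\<^sub>F x in inf (nhds l) (filtermap f U). False"
        unfolding eventually_inf by blast
      then show False using l by (simp add: trivial_limit_def)
    qed
  qed
  then show ?thesis by blast
qed

locale metric_group_family =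
  fixes U :: "nat filter" and G :: "nat \<Rightarrow> ('a, 'b) monoid_scheme"
    and nrm :: "nat \<Rightarrow> 'a \<Rightarrow> real"
  assumes mg: "metric_group (G n) (nrm n)"
    and nrm_le_1: "g \<in> carrier (G n) \<Longrightarrow> nrm n g \<le> 1"
    and ultra: "ultrafilter U"
begin

abbreviation "P \<equiv> product_group UNIV G"
abbreviation "E \<equiv> met_null U G nrm"

lemma G_group: "group (G n)"
  using mg[of n] by (simp add: metric_group_def)

lemma nrm_pos: "g \<in> carrier (G n) \<Longrightarrow> 0 \<le> nrm n g"
  using metric_group.nrm_nonneg[OF mg] .

lemma P_group: "group P"
  by (simp add: G_group)

lemma P_carrier: "g \<in> carrier P \<Longrightarrow> g n \<in> carrier (G n)"
  by auto

lemma P_inv: "g \<in> carrier P \<Longrightarrow> inv\<^bsub>P\<^esub> g = (\<lambda>n. inv\<^bsub>G n\<^esub> g n)"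
  by (subst inv_product_group) (auto simp: G_group)

lemma P_convergent:
  assumes "g \<in> carrier P"
  shows "\<exists>l. ((\<lambda>n. nrm n (g n)) \<longlongrightarrow> l) U"
  by (rule ultrafilter_convergent[OF ultra, of 0 _ 1])
     (rule nrm_pos nrm_le_1, rule P_carrier[OF assms])+

lemma met_null_subgroup: "subgroup E P"
proof
  show "E \<subseteq> carrier P" by (auto simp: met_null_def)
next
  fix g h assume g: "g \<in> E" and h: "h \<in> E"
  then have gh: "g \<in> carrier P" "h \<in> carrier P" by (auto simp: met_null_def)
  have "((\<lambda>n. nrm n (g n) + nrm n (h n)) \<longlongrightarrow> 0 + 0) U"
    using g h by (intro tendsto_add) (auto simp: met_null_def)
  then have lim: "((\<lambda>n. nrm n (g n) + nrm n (h n)) \<longlongrightarrow> 0) U" by simp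
  have bd: "0 \<le> nrm n (g n \<otimes>\<^bsub>G n\<^esub> h n) \<and>
      nrm n (g n \<otimes>\<^bsub>G n\<^esub> h n) \<le> nrm n (g n) + nrm n (h n)" for n
  proof -
    interpret metric_group "G n" "nrm n" by (rule mg)
    show ?thesis
      using P_carrier[OF gh(1)] P_carrier[OF gh(2)] by (simp add: nrm_nonneg nrm_mult)
  qed
  have "((\<lambda>n. nrm n (g n \<otimes>\<^bsub>G n\<^esub> h n)) \<longlongrightarrow> 0) U"
    by (rule tendsto_sandwich[OF _ _ tendsto_const lim]) (simp_all add: bd)
  moreover have "g \<otimes>\<^bsub>P\<^esub> h \<in> carrier P"
    using group.is_monoid[OF P_group] gh by (rule monoid.m_closed)
  ultimately show "g \<otimes>\<^bsub>P\<^esub> h \<in> E"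
    by (simp add: met_null_def)
next
  have "\<one>\<^bsub>P\<^esub> \<in> carrier P"
    using group.is_monoid[OF P_group] by (rule monoid.one_closed)
  then show "\<one>\<^bsub>P\<^esub> \<in> E"
    by (simp add: met_null_def metric_group.nrm_one[OF mg])
next
  fix g assume g: "g \<in> E"
  then have gc: "g \<in> carrier P" by (auto simp: met_null_def)
  show "inv\<^bsub>P\<^esub> g \<in> E"
    using g group.inv_closed[OF P_group gc] P_inv[OF gc] P_carrier[OF gc]
      metric_group.nrm_inv[OF mg]
    by (simp add: met_null_def)
qed

lemma met_null_normal: "E \<lhd> P"
  unfolding group.normal_inv_iff[OF P_group]
proof (intro conjI ballI)
  show "subgroup E P" by (rule met_null_subgroup)
next
  fix x h assume x: "x \<in> carrier P" and h: "h \<in> E"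
  then have hc: "h \<in> carrier P" by (auto simp: met_null_def)
  interpret P: group P by (rule P_group)
  have "x \<otimes>\<^bsub>P\<^esub> h \<otimes>\<^bsub>P\<^esub> inv\<^bsub>P\<^esub> x \<in> carrier P"
    using x hc P.m_closed P.inv_closed by blast
  then show "x \<otimes>\<^bsub>P\<^esub> h \<otimes>\<^bsub>P\<^esub> inv\<^bsub>P\<^esub> x \<in> E"
    using h P_inv[OF x] P_carrier[OF x] P_carrier[OF hc] metric_group.nrm_conj[OF mg]
    by (simp add: met_null_def)
qed

lemma met_ultraproduct_group: "group (met_ultraproduct U G nrm)"
  unfolding met_ultraproduct_def by (rule normal.factorgroup_is_group[OF met_null_normal])

lemma tendsto_ultra_norm:
  assumes X: "X \<in> carrier (met_ultraproduct U G nrm)" and g: "g \<in> X"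
  shows "((\<lambda>n. nrm n (g n)) \<longlongrightarrow> ultra_norm U nrm X) U"
proof -
  obtain a where a: "a \<in> carrier P" and Xa: "X = E #>\<^bsub>P\<^esub> a"
    using X unfolding met_ultraproduct_def FactGroup_def RCOSETS_def by auto
  obtain l where l: "((\<lambda>n. nrm n (a n)) \<longlongrightarrow> l) U" using P_convergent[OF a] by blast
  have *: "((\<lambda>n. nrm n (b n)) \<longlongrightarrow> l) U" if b: "b \<in> X" for b
  proof -
    obtain e where e: "e \<in> E" and be: "b = e \<otimes>\<^bsub>P\<^esub> a"
      using b Xa by (auto simp: r_coset_def)
    have ec: "e \<in> carrier P" and e0: "((\<lambda>n. nrm n (e n)) \<longlongrightarrow> 0) U"
      using e by (auto simp: met_null_def)
    have bd: "nrm n (b n) \<le> nrm n (e n) + nrm n (a n) \<and>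
              nrm n (a n) - nrm n (e n) \<le> nrm n (b n)" for n
    proof -
      interpret metric_group "G n" "nrm n" by (rule mg)
      have c: "e n \<in> carrier (G n)" "a n \<in> carrier (G n)"
        using P_carrier[OF ec] P_carrier[OF a] by auto
      have bn: "b n = e n \<otimes>\<^bsub>G n\<^esub> a n" using be by simp
      have "a n = inv\<^bsub>G n\<^esub> e n \<otimes>\<^bsub>G n\<^esub> b n" using c bn by (simp add: m_assoc[symmetric])
      then have "nrm n (a n) \<le> nrm n (inv\<^bsub>G n\<^esub> e n) + nrm n (b n)"
        using nrm_mult[of "inv\<^bsub>G n\<^esub> e n" "b n"] c bn by simp
      then show ?thesis using nrm_mult[OF c] nrm_inv[OF c(1)] bn by simp
    qed
    have up: "((\<lambda>n. nrm n (e n) + nrm n (a n)) \<longlongrightarrow> l) U"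
      using tendsto_add[OF e0 l] by simp
    have lo: "((\<lambda>n. nrm n (a n) - nrm n (e n)) \<longlongrightarrow> l) U"
      using tendsto_diff[OF l e0] by simp
    show ?thesis
      by (rule tendsto_sandwich[OF _ _ lo up]) (simp_all add: bd)
  qed
  have "U \<noteq> bot" using ultra by (simp add: ultrafilter_def)
  then have "r = l" if "\<forall>h\<in>X. ((\<lambda>n. nrm n (h n)) \<longlongrightarrow> r) U" for r
    using that *[OF g] g tendsto_unique by blast
  then have "ultra_norm U nrm X = l"
    unfolding ultra_norm_def using * by (intro the_equality) blast+
  then show ?thesis using *[OF g] by simp
qed

end

end

(* Let M be the set of sequences g whose widths N(g_n, G_n) tend to infinity along U. By the second
   part of the star property M is, if nonempty, a normal subgroup of the product, so by simplicity
   its image in the ultraproduct is everything or trivial. It is not everything: otherwise a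
   sequence of elements of bounded width, as in the first part of the star property, is congruent
   to an element of M, which yields a null sequence of bounded width, and then the norms of the
   G_n tend to 0 uniformly. So M consists of null sequences. If elements of norm > r
   had unbounded widths in the ultraproduct, a diagonal sequence would lie in M without being
   null. *)

theory Submission
  imports Defs
begin

section \<open>Products of conjugates and widths in a single group\<close>

definition conj_pm :: "'a \<Rightarrow> ('a, 'b) monoid_scheme \<Rightarrow> 'a set" where
  "conj_pm g G = {h \<otimes>\<^bsub>G\<^esub> x \<otimes>\<^bsub>G\<^esub> inv\<^bsub>G\<^esub> h | h x. h \<in> carrier G \<and> x \<in> {g, inv\<^bsub>G\<^esub> g}}"

lemma conj_prods_altdef:
  "conj_prods N g G =
     {foldr (\<otimes>\<^bsub>G\<^esub>) xs \<one>\<^bsub>G\<^esub> | xs. length xs \<le> N \<and> set xs \<subseteq> conj_pm g G}"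
  by (simp add: conj_prods_def conj_pm_def)

lemma conj_prods_0: "conj_prods 0 g G = {\<one>\<^bsub>G\<^esub>}"
  by (auto simp: conj_prods_altdef)

lemma one_in_conj_prods: "\<one>\<^bsub>G\<^esub> \<in> conj_prods N g G"
  unfolding conj_prods_altdef by (rule CollectI, rule exI[of _ "[]"]) simp

text \<open>Peeling off the first factor makes induction on the number of factors possible. The
  identity is listed separately because the product may be empty: for \<open>N = 0\<close> in a
  group the other set contains it only if \<open>g\<close> is trivial.\<close>

lemma conj_prods_Suc:
  "conj_prods (Suc N) g G =
     insert \<one>\<^bsub>G\<^esub> {c \<otimes>\<^bsub>G\<^esub> y | c y. c \<in> conj_pm g G \<and> y \<in> conj_prods N g G}"
proof (intro equalityI subsetI)
  fix z assume "z \<in> conj_prods (Suc N) g G"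
  then obtain xs where xs: "z = foldr (\<otimes>\<^bsub>G\<^esub>) xs \<one>\<^bsub>G\<^esub>" "length xs \<le> Suc N"
    "set xs \<subseteq> conj_pm g G"
    by (auto simp: conj_prods_altdef)
  show "z \<in> insert \<one>\<^bsub>G\<^esub> {c \<otimes>\<^bsub>G\<^esub> y | c y. c \<in> conj_pm g G \<and> y \<in> conj_prods N g G}"
    using xs by (cases xs) (auto simp: conj_prods_altdef)
next
  fix z
  assume "z \<in> insert \<one>\<^bsub>G\<^esub> {c \<otimes>\<^bsub>G\<^esub> y | c y. c \<in> conj_pm g G \<and> y \<in> conj_prods N g G}"
  then consider "z = \<one>\<^bsub>G\<^esub>"
    | c xs where "c \<in> conj_pm g G" "length xs \<le> N" "set xs \<subseteq> conj_pm g G"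
        "z = foldr (\<otimes>\<^bsub>G\<^esub>) (c # xs) \<one>\<^bsub>G\<^esub>"
    by (auto simp: conj_prods_altdef)
  then show "z \<in> conj_prods (Suc N) g G"
  proof cases
    case 1
    then show ?thesis by (simp add: one_in_conj_prods)
  next
    case 2
    then show ?thesis
      unfolding conj_prods_altdef by (intro CollectI exI[of _ "c # xs"]) simp
  qed
qed

lemma conj_prods_mono: "M \<le> N \<Longrightarrow> conj_prods M g G \<subseteq> conj_prods N g G"
  by (auto simp: conj_prods_altdef)

lemma conj_prods_pm_mono:
  "conj_pm g G \<subseteq> conj_pm h G \<Longrightarrow> conj_prods N g G \<subseteq> conj_prods N h G"
  by (auto simp: conj_prods_altdef)

lemma conj_width_le: "conj_prods N g G = carrier G \<Longrightarrow> conj_width g G \<le> enat N"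
  unfolding conj_width_def by (rule Inf_lower) auto

context group
begin

lemma conj_pm_carrier: "g \<in> carrier G \<Longrightarrow> conj_pm g G \<subseteq> carrier G"
  by (auto simp: conj_pm_def)

lemma conj_prods_carrier: "g \<in> carrier G \<Longrightarrow> conj_prods N g G \<subseteq> carrier G"
proof (induction N)
  case (Suc N)
  then show ?case using conj_pm_carrier by (auto simp: conj_prods_Suc)
qed (simp add: conj_prods_0)

lemma conj_prods_eq_carrier_mono:
  assumes "g \<in> carrier G" "conj_prods M g G = carrier G" "M \<le> N"
  shows "conj_prods N g G = carrier G"
  using conj_prods_mono[OF assms(3), of g G] conj_prods_carrier[OF assms(1), of N] assms(2)
  by auto

text \<open>Counterpart of \<open>conj_width_le\<close>: an infimum below \<open>l\<close> means
  that some \<open>n < l\<close> suffices, and allowing more factors does no harm because shorter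
  products still count.\<close>

lemma conj_prods_eq_carrier:
  assumes g: "g \<in> carrier G" and l: "conj_width g G < enat l"
  shows "conj_prods l g G = carrier G"
proof -
  obtain n where n: "conj_prods n g G = carrier G" "n < l"
    using l unfolding conj_width_def Inf_less_iff by auto
  then show ?thesis using conj_prods_eq_carrier_mono[OF g n(1)] by simp
qed

text \<open>Each number of factors that suffices for \<open>g\<close> also suffices for
  \<open>h\<close>, so the infimum for \<open>h\<close> runs over a larger set.\<close>

lemma conj_width_pm_antimono:
  assumes h: "h \<in> carrier G" and sub: "conj_pm g G \<subseteq> conj_pm h G"
  shows "conj_width h G \<le> conj_width g G"
  unfolding conj_width_def
  using conj_prods_pm_mono[OF sub] conj_prods_carrier[OF h] by (intro Inf_superset_mono) blast

text \<open>An element and its inverse have the same \<open>conj_pm\<close>. The direction recorded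
  is the one that keeps large widths large.\<close>

lemma conj_width_inv: "g \<in> carrier G \<Longrightarrow> conj_width g G \<le> conj_width (inv g) G"
  by (rule conj_width_pm_antimono) (auto simp: conj_pm_def)

text \<open>Inversion commutes with conjugation, and a conjugate of a conjugate is a conjugate by
  the product \<open>h \<otimes> a\<close>, so passing from \<open>g\<close> to a conjugate creates
  no new factors.\<close>

lemma conj_width_conj:
  assumes g: "g \<in> carrier G" and a: "a \<in> carrier G"
  shows "conj_width g G \<le> conj_width (a \<otimes> g \<otimes> inv a) G"
proof (rule conj_width_pm_antimono[OF g])
  have "h \<otimes> x \<otimes> inv h \<in> conj_pm g G"
    if h: "h \<in> carrier G" and x: "x \<in> {a \<otimes> g \<otimes> inv a, inv (a \<otimes> g \<otimes> inv a)}" for h x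
  proof -
    have "inv (a \<otimes> g \<otimes> inv a) = a \<otimes> inv g \<otimes> inv a"
      using g a by (simp add: inv_mult_group m_assoc)
    with x obtain y where y: "y \<in> {g, inv g}" "x = a \<otimes> y \<otimes> inv a" by blast
    then have "h \<otimes> x \<otimes> inv h = (h \<otimes> a) \<otimes> y \<otimes> inv (h \<otimes> a)"
      using g a h by (auto simp: inv_mult_group m_assoc)
    then show ?thesis
      using y a h unfolding conj_pm_def by blast
  qed
  then show "conj_pm (a \<otimes> g \<otimes> inv a) G \<subseteq> conj_pm g G"
    unfolding conj_pm_def[of "a \<otimes> g \<otimes> inv a"] by blast
qed

end

text \<open>Each factor has the norm of \<open>g\<close>, by invariance under inversion and
  conjugation; the triangle inequality adds up at most \<open>N\<close> of them.\<close>

lemma (in metric_group) nrm_conj_prods: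
  assumes g: "g \<in> carrier G" and x: "x \<in> conj_prods N g G"
  shows "nrm x \<le> real N * nrm g"
  using x
proof (induction N arbitrary: x)
  case 0
  then show ?case by (simp add: conj_prods_0 nrm_one)
next
  case (Suc N)
  from Suc.prems consider "x = \<one>"
    | c y where "c \<in> conj_pm g G" "y \<in> conj_prods N g G" "x = c \<otimes> y"
    by (auto simp: conj_prods_Suc)
  then show ?case
  proof cases
    case 1
    then show ?thesis using nrm_nonneg[OF g] by (simp add: nrm_one)
  next
    case 2
    have "nrm c = nrm g"
      using 2(1) g by (auto simp: conj_pm_def nrm_conj nrm_inv)
    moreover have "nrm x \<le> nrm c + nrm y"
      using 2 conj_pm_carrier[OF g] conj_prods_carrier[OF g] by (auto intro!: nrm_mult)
    ultimately show ?thesis using Suc.IH[OF 2(2)] by (simp add: algebra_simps)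
  qed
qed

section \<open>Ultrafilters, and normal subgroups under surjections\<close>

lemma ultrafilter_disj:
  assumes "ultrafilter U" "\<forall>\<^sub>F n in U. P n \<or> Q n"
  shows "(\<forall>\<^sub>F n in U. P n) \<or> (\<forall>\<^sub>F n in U. Q n)"
proof (cases "\<forall>\<^sub>F n in U. P n")
  case False
  then have "\<forall>\<^sub>F n in U. \<not> P n" using assms(1) by (auto simp: ultrafilter_def)
  with assms(2) have "\<forall>\<^sub>F n in U. Q n" by eventually_elim auto
  then show ?thesis ..
qed simp

text \<open>A member of the ultrafilter remains one when a single index is removed, so any finite
  initial segment can be discarded.\<close>

lemma nonprincipal_eventually_ge:
  fixes U :: "nat filter"
  assumes "ultrafilter U" "nonprincipal U"
  shows "\<forall>\<^sub>F n in U. k \<le> n"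
proof (induction k)
  case (Suc k)
  moreover have "\<forall>\<^sub>F n in U. n \<noteq> k"
    using assms by (auto simp: ultrafilter_def nonprincipal_def)
  ultimately show ?case by eventually_elim auto
qed simp

text \<open>Surjectivity lifts each conjugating element of \<open>H\<close> to \<open>G\<close>,
  where normality of \<open>M\<close> applies.\<close>

lemma normal_image_surj_hom:
  assumes G: "group G" and H: "group H" and f: "f \<in> hom G H"
    and surj: "f ` carrier G = carrier H" and M: "M \<lhd> G"
  shows "f ` M \<lhd> H"
proof -
  interpret f: group_hom G H f using G H f by (simp add: group_hom_def group_hom_axioms_def)
  have MG: "subgroup M G" using M by (simp add: normal_imp_subgroup)
  have "x \<otimes>\<^bsub>H\<^esub> y \<otimes>\<^bsub>H\<^esub> inv\<^bsub>H\<^esub> x \<in> f ` M" if x: "x \<in> carrier H" and y: "y \<in> f ` M" for x y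
  proof -
    obtain a where a: "a \<in> carrier G" "x = f a" using x surj by blast
    obtain m where m: "m \<in> M" "y = f m" using y by blast
    have mc: "m \<in> carrier G" using m(1) subgroup.mem_carrier[OF MG] by blast
    have "x \<otimes>\<^bsub>H\<^esub> y \<otimes>\<^bsub>H\<^esub> inv\<^bsub>H\<^esub> x = f (a \<otimes>\<^bsub>G\<^esub> m \<otimes>\<^bsub>G\<^esub> inv\<^bsub>G\<^esub> a)"
      using a m mc by simp
    moreover have "a \<otimes>\<^bsub>G\<^esub> m \<otimes>\<^bsub>G\<^esub> inv\<^bsub>G\<^esub> a \<in> M"
      using M a m f.G.normal_inv_iff by blast
    ultimately show ?thesis by simp
  qed
  then show ?thesis
    using f.subgroup_img_is_subgroup[OF MG] f.H.normal_inv_iff by blast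
qed

section \<open>The quotient map onto the metric ultraproduct\<close>

context metric_group_family
begin

abbreviation "Q \<equiv> met_ultraproduct U G nrm"
abbreviation "cls \<equiv> (\<lambda>g. E #>\<^bsub>P\<^esub> g)"

lemma cls_hom: "cls \<in> hom P Q"
  unfolding met_ultraproduct_def by (rule normal.r_coset_hom_Mod[OF met_null_normal])

lemma cls_surj: "cls ` carrier P = carrier Q"
  by (auto simp: met_ultraproduct_def FactGroup_def RCOSETS_def)

lemma cls_group_hom: "group_hom P Q cls"
  using P_group met_ultraproduct_group cls_hom by (simp add: group_hom_def group_hom_axioms_def)

lemma cls_eqE:
  assumes "a \<in> carrier P" "b \<in> carrier P" "cls a = cls b"
  obtains e where "e \<in> E" "a = e \<otimes>\<^bsub>P\<^esub> b"
proof -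
  have "a \<in> cls b"
    using assms group.rcos_self[OF P_group assms(1) met_null_subgroup] by simp
  then show ?thesis using that by (auto simp: r_coset_def)
qed

text \<open>The quotient of the two sequences has norm 0 at \<open>U\<close>-many indices, so its
  norms tend to 0 and it lies in \<open>E\<close>. Values outside a member of \<open>U\<close> can
  thus be chosen freely.\<close>

lemma cls_eventually_eq:
  assumes a: "a \<in> carrier P" and b: "b \<in> carrier P" and ev: "\<forall>\<^sub>F n in U. a n = b n"
  shows "cls a = cls b"
proof -
  interpret P: group P by (rule P_group)
  have c: "a \<otimes>\<^bsub>P\<^esub> inv\<^bsub>P\<^esub> b \<in> carrier P"
    using a b P.m_closed P.inv_closed by blast
  have "\<forall>\<^sub>F n in U. nrm n ((a \<otimes>\<^bsub>P\<^esub> inv\<^bsub>P\<^esub> b) n) = 0"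
    using ev
  proof eventually_elim
    case (elim n)
    then show ?case
      using P_carrier[OF b, of n] group.r_inv[OF G_group] metric_group.nrm_one[OF mg]
      by (simp add: P_inv[OF b])
  qed
  then have "((\<lambda>n. nrm n ((a \<otimes>\<^bsub>P\<^esub> inv\<^bsub>P\<^esub> b) n)) \<longlongrightarrow> 0) U"
    by (rule tendsto_eventually)
  then have "a \<otimes>\<^bsub>P\<^esub> inv\<^bsub>P\<^esub> b \<in> E"
    using c by (simp add: met_null_def)
  moreover have "a = (a \<otimes>\<^bsub>P\<^esub> inv\<^bsub>P\<^esub> b) \<otimes>\<^bsub>P\<^esub> b"
    using a b P.m_assoc P.l_inv P.r_one P.inv_closed by metis
  ultimately have "a \<in> cls b"
    unfolding r_coset_def by blast
  then show ?thesis
    using P.repr_independence[OF _ b met_null_subgroup] by simp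
qed

lemma one_carrier_P: "\<one>\<^bsub>P\<^esub> \<in> carrier P"
  using group.is_monoid[OF P_group] by (rule monoid.one_closed)

text \<open>The number of factors and the exponents depend on the index; the ultrafilter
  selects one pattern.\<close>

lemma cls_in_conj_prods:
  assumes g: "g \<in> carrier P"
  shows "\<lbrakk>h \<in> carrier P; \<forall>\<^sub>F n in U. h n \<in> conj_prods N (g n) (G n)\<rbrakk>
    \<Longrightarrow> cls h \<in> conj_prods N (cls g) Q"
proof (induction N arbitrary: h)
  case 0
  interpret group_hom P Q cls by (rule cls_group_hom)
  have "\<forall>\<^sub>F n in U. h n = \<one>\<^bsub>P\<^esub> n" using 0(2) by (simp add: conj_prods_0)
  then show ?case
    using cls_eventually_eq[OF 0(1) one_carrier_P] hom_one by (simp add: conj_prods_0)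
next
  case (Suc N)
  interpret group_hom P Q cls by (rule cls_group_hom)
  \<comment> \<open>The sequence \<open>x\<close> will be \<open>g\<close> or its inverse, so the
    first factor has the same exponent at \<open>U\<close>-many indices. The class of
    \<open>h\<close> then splits into a conjugate of \<open>cls x\<close> and a shorter product
    covered by the induction hypothesis.\<close>
  have step: "cls h \<in> conj_prods (Suc N) (cls g) Q"
    if x: "x \<in> carrier P" "cls x \<in> {cls g, inv\<^bsub>Q\<^esub> (cls g)}"
      and ev: "\<forall>\<^sub>F n in U. \<exists>a y. a \<in> carrier (G n) \<and> y \<in> conj_prods N (g n) (G n) \<and>
          h n = a \<otimes>\<^bsub>G n\<^esub> x n \<otimes>\<^bsub>G n\<^esub> inv\<^bsub>G n\<^esub> a \<otimes>\<^bsub>G n\<^esub> y" for x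
  proof -
    define R where "R n p \<longleftrightarrow> fst p \<in> carrier (G n) \<and> snd p \<in> conj_prods N (g n) (G n) \<and>
      h n = fst p \<otimes>\<^bsub>G n\<^esub> x n \<otimes>\<^bsub>G n\<^esub> inv\<^bsub>G n\<^esub> fst p \<otimes>\<^bsub>G n\<^esub> snd p" for n p
    \<comment> \<open>A choice of conjugator and remaining product at each index. The identity is
      the default where none exists, so that both sequences lie in \<open>carrier P\<close>.\<close>
    define p where "p n = (if \<exists>p. R n p then SOME p. R n p else (\<one>\<^bsub>G n\<^esub>, \<one>\<^bsub>G n\<^esub>))" for n
    define a where "a n = fst (p n)" for n
    define y where "y n = snd (p n)" for n
    have pR: "R n (p n)" if "\<exists>p. R n p" for n
      using that someI_ex[OF that] by (simp add: p_def)
    have ac: "a n \<in> carrier (G n)" and yc: "y n \<in> carrier (G n)" for n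
    proof -
      interpret group "G n" by (rule G_group)
      have "fst (p n) \<in> carrier (G n) \<and> snd (p n) \<in> carrier (G n)"
      proof (cases "\<exists>p. R n p")
        case True
        then show ?thesis
          using pR[OF True] conj_prods_carrier[OF P_carrier[OF g, of n]] by (auto simp: R_def)
      qed (simp add: p_def)
      then show "a n \<in> carrier (G n)" "y n \<in> carrier (G n)" by (auto simp: a_def y_def)
    qed
    have aP: "a \<in> carrier P" and yP: "y \<in> carrier P" using ac yc by auto
    have evR: "\<forall>\<^sub>F n in U. R n (p n)"
      using ev
    proof eventually_elim
      case (elim n)
      then have "\<exists>p. R n p" by (simp add: R_def)
      then show ?case by (rule pR)
    qed
    have "\<forall>\<^sub>F n in U. y n \<in> conj_prods N (g n) (G n)"
      using evR by eventually_elim (simp add: R_def y_def)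
    then have y': "cls y \<in> conj_prods N (cls g) Q" by (rule Suc.IH[OF yP])
    let ?w = "a \<otimes>\<^bsub>P\<^esub> x \<otimes>\<^bsub>P\<^esub> inv\<^bsub>P\<^esub> a"
    have wP: "?w \<in> carrier P" using aP x(1) G.m_closed G.inv_closed by blast
    have "\<forall>\<^sub>F n in U. h n = (?w \<otimes>\<^bsub>P\<^esub> y) n"
      using evR by eventually_elim (simp add: R_def y_def a_def P_inv[OF aP])
    then have "cls h = cls (?w \<otimes>\<^bsub>P\<^esub> y)"
      using cls_eventually_eq[OF Suc.prems(1)] G.m_closed[OF wP yP] by blast
    also have "\<dots> = (cls a \<otimes>\<^bsub>Q\<^esub> cls x \<otimes>\<^bsub>Q\<^esub> inv\<^bsub>Q\<^esub> (cls a)) \<otimes>\<^bsub>Q\<^esub> cls y"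
      using aP x(1) yP wP G.m_closed G.inv_closed hom_mult hom_inv by metis
    finally have eq: "cls h = (cls a \<otimes>\<^bsub>Q\<^esub> cls x \<otimes>\<^bsub>Q\<^esub> inv\<^bsub>Q\<^esub> (cls a)) \<otimes>\<^bsub>Q\<^esub> cls y" .
    have "cls a \<otimes>\<^bsub>Q\<^esub> cls x \<otimes>\<^bsub>Q\<^esub> inv\<^bsub>Q\<^esub> (cls a) \<in> conj_pm (cls g) Q"
      unfolding conj_pm_def using x(2) hom_closed[OF aP] by blast
    then show ?thesis unfolding conj_prods_Suc eq using y' by blast
  qed
  let ?ev = "\<lambda>x n. \<exists>a y. a \<in> carrier (G n) \<and> y \<in> conj_prods N (g n) (G n) \<and>
          h n = a \<otimes>\<^bsub>G n\<^esub> x n \<otimes>\<^bsub>G n\<^esub> inv\<^bsub>G n\<^esub> a \<otimes>\<^bsub>G n\<^esub> y"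
  have "\<forall>\<^sub>F n in U. h n = \<one>\<^bsub>P\<^esub> n \<or> (?ev g n \<or> ?ev (inv\<^bsub>P\<^esub> g) n)"
    using Suc.prems(2)
  proof eventually_elim
    case (elim n)
    then consider "h n = \<one>\<^bsub>G n\<^esub>"
      | a x y where "a \<in> carrier (G n)" "x = g n \<or> x = inv\<^bsub>G n\<^esub> (g n)"
          "y \<in> conj_prods N (g n) (G n)"
          "h n = a \<otimes>\<^bsub>G n\<^esub> x \<otimes>\<^bsub>G n\<^esub> inv\<^bsub>G n\<^esub> a \<otimes>\<^bsub>G n\<^esub> y"
      unfolding conj_prods_Suc conj_pm_def by blast
    then show ?case
    proof cases
      case 1
      then show ?thesis by simp
    next
      case 2
      then show ?thesis unfolding P_inv[OF g] by blast
    qed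
  qed
  \<comment> \<open>Three shapes occur: the empty product, a first factor conjugate to
    \<open>g\<close>, or one conjugate to its inverse. A single one of them must hold at
    \<open>U\<close>-many indices.\<close>
  from ultrafilter_disj[OF ultra this]
  consider "\<forall>\<^sub>F n in U. h n = \<one>\<^bsub>P\<^esub> n" | "\<forall>\<^sub>F n in U. ?ev g n"
    | "\<forall>\<^sub>F n in U. ?ev (inv\<^bsub>P\<^esub> g) n"
    by (elim disjE) (use ultrafilter_disj[OF ultra, of "?ev g" "?ev (inv\<^bsub>P\<^esub> g)"] in argo)+
  then show ?case
  proof cases
    case 1
    then show ?thesis
      using cls_eventually_eq[OF Suc.prems(1) one_carrier_P] hom_one
      by (simp add: one_in_conj_prods)
  next
    case 2
    show ?thesis by (rule step[OF g _ 2]) simp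
  next
    case 3
    show ?thesis
      by (rule step[OF G.inv_closed[OF g] _ 3]) (simp only: hom_inv[OF g] insert_iff simp_thms)
  qed
qed

section \<open>Sequences of unbounded width\<close>

text \<open>The set M of the proof idea; an infinite width counts as large.\<close>

definition wide :: "(nat \<Rightarrow> 'a) set" where
  "wide = {g \<in> carrier P. \<forall>k. \<forall>\<^sub>F n in U. enat k \<le> conj_width (g n) (G n)}"

text \<open>Closure under products is the second part of the star property, with a threshold
  \<open>l\<close> for each \<open>k\<close>; inverses and conjugates have widths at least as large.
  Nonemptiness has to be assumed: if all groups are trivial, all widths are 0 and
  \<open>wide\<close> is empty.\<close>

lemma wide_normal:
  assumes star: "star_property (range G)" and ne: "wide \<noteq> {}"
  shows "wide \<lhd> P"
proof -
  interpret P: group P by (rule P_group)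
  have "subgroup wide P"
  proof (rule P.subgroupI)
    show "wide \<subseteq> carrier P" by (simp add: wide_def)
    show "wide \<noteq> {}" by (rule ne)
  next
    fix a assume "a \<in> wide"
    then have a: "a \<in> carrier P" and w: "\<And>k. \<forall>\<^sub>F n in U. enat k \<le> conj_width (a n) (G n)"
      by (auto simp: wide_def)
    have "\<forall>\<^sub>F n in U. enat k \<le> conj_width ((inv\<^bsub>P\<^esub> a) n) (G n)" for k
      using w[of k]
    proof eventually_elim
      case (elim n)
      note elim
      also have "conj_width (a n) (G n) \<le> conj_width (inv\<^bsub>G n\<^esub> a n) (G n)"
        by (rule group.conj_width_inv[OF G_group P_carrier[OF a]])
      finally show ?case by (simp add: P_inv[OF a])
    qed
    then show "inv\<^bsub>P\<^esub> a \<in> wide" using P.inv_closed[OF a] by (simp add: wide_def)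
  next
    fix a b assume "a \<in> wide" "b \<in> wide"
    then have a: "a \<in> carrier P" and wa: "\<And>k. \<forall>\<^sub>F n in U. enat k \<le> conj_width (a n) (G n)"
      and b: "b \<in> carrier P" and wb: "\<And>k. \<forall>\<^sub>F n in U. enat k \<le> conj_width (b n) (G n)"
      by (auto simp: wide_def)
    have "\<forall>\<^sub>F n in U. enat k \<le> conj_width ((a \<otimes>\<^bsub>P\<^esub> b) n) (G n)" for k
    proof -
      obtain l where l: "\<And>n g h. g \<in> carrier (G n) \<Longrightarrow> h \<in> carrier (G n) \<Longrightarrow>
          enat l \<le> conj_width g (G n) \<Longrightarrow> enat l \<le> conj_width h (G n) \<Longrightarrow>
          enat k \<le> conj_width (g \<otimes>\<^bsub>G n\<^esub> h) (G n)"
        using star unfolding star_property_def by blast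
      show ?thesis
        using wa[of l] wb[of l]
        by eventually_elim (use l P_carrier[OF a] P_carrier[OF b] in simp)
    qed
    then show "a \<otimes>\<^bsub>P\<^esub> b \<in> wide" using P.m_closed[OF a b] by (simp add: wide_def)
  qed
  moreover have "x \<otimes>\<^bsub>P\<^esub> a \<otimes>\<^bsub>P\<^esub> inv\<^bsub>P\<^esub> x \<in> wide" if x: "x \<in> carrier P" and "a \<in> wide" for x a
  proof -
    have a: "a \<in> carrier P" and w: "\<And>k. \<forall>\<^sub>F n in U. enat k \<le> conj_width (a n) (G n)"
      using \<open>a \<in> wide\<close> by (auto simp: wide_def)
    have "\<forall>\<^sub>F n in U. enat k \<le> conj_width ((x \<otimes>\<^bsub>P\<^esub> a \<otimes>\<^bsub>P\<^esub> inv\<^bsub>P\<^esub> x) n) (G n)" for k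
      using w[of k]
    proof eventually_elim
      case (elim n)
      note elim
      also have "conj_width (a n) (G n) \<le> conj_width (x n \<otimes>\<^bsub>G n\<^esub> a n \<otimes>\<^bsub>G n\<^esub> inv\<^bsub>G n\<^esub> x n) (G n)"
        by (rule group.conj_width_conj[OF G_group P_carrier[OF a] P_carrier[OF x]])
      finally show ?case by (simp add: P_inv[OF x])
    qed
    moreover have "x \<otimes>\<^bsub>P\<^esub> a \<otimes>\<^bsub>P\<^esub> inv\<^bsub>P\<^esub> x \<in> carrier P"
      using x a P.m_closed P.inv_closed by blast
    ultimately show ?thesis by (simp add: wide_def)
  qed
  ultimately show ?thesis using P.normal_inv_iff by blast
qed

text \<open>At \<open>U\<close>-many indices \<open>x n\<close> is a product of at most
  \<open>l\<close> conjugates of \<open>e n\<close> and its inverse, so its norm is at most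
  \<open>l\<close> times that of \<open>e n\<close>, which tends to 0.\<close>

lemma bounded_width_null_imp_trivial:
  assumes e: "e \<in> E" and w: "\<forall>\<^sub>F n in U. conj_width (e n) (G n) < enat l"
  shows "carrier P \<subseteq> E"
proof
  fix x assume x: "x \<in> carrier P"
  have ec: "e \<in> carrier P" and e0: "((\<lambda>n. nrm n (e n)) \<longlongrightarrow> 0) U"
    using e by (auto simp: met_null_def)
  have lim: "((\<lambda>n. real l * nrm n (e n)) \<longlongrightarrow> 0) U"
    using tendsto_mult_right_zero[OF e0] .
  have "\<forall>\<^sub>F n in U. nrm n (x n) \<le> real l * nrm n (e n)"
    using w
  proof eventually_elim
    case (elim n)
    interpret metric_group "G n" "nrm n" by (rule mg)
    have "x n \<in> conj_prods l (e n) (G n)"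
      using conj_prods_eq_carrier[OF P_carrier[OF ec] elim] P_carrier[OF x] by simp
    then show ?case by (rule nrm_conj_prods[OF P_carrier[OF ec]])
  qed
  moreover have "\<forall>\<^sub>F n in U. 0 \<le> nrm n (x n)"
    using nrm_pos[OF P_carrier[OF x]] by simp
  ultimately have "((\<lambda>n. nrm n (x n)) \<longlongrightarrow> 0) U"
    by (intro tendsto_sandwich[OF _ _ tendsto_const lim])
  then show "x \<in> E" using x by (simp add: met_null_def)
qed

text \<open>Both possibilities for the image of \<open>wide\<close> lead into \<open>E\<close>: if
  the image is all of \<open>Q\<close>, every sequence turns out to be null; if it is trivial,
  \<open>wide\<close> lies in the kernel of \<open>cls\<close>.\<close>

lemma wide_subset_null:
  assumes star: "star_property (range G)" and simple: "simple_grp Q"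
  shows "wide \<subseteq> E"
proof
  fix y assume y: "y \<in> wide"
  then have yP: "y \<in> carrier P" by (simp add: wide_def)
  interpret group_hom P Q cls by (rule cls_group_hom)
  \<comment> \<open>The given \<open>y\<close> supplies the nonemptiness required for normality of
    \<open>wide\<close>.\<close>
  have "cls ` wide \<lhd> Q"
    using normal_image_surj_hom[OF P_group met_ultraproduct_group cls_hom cls_surj]
      wide_normal[OF star] y by blast
  then consider "cls ` wide = carrier Q" | "cls ` wide = {\<one>\<^bsub>Q\<^esub>}"
    using simple unfolding simple_grp_def by blast
  then show "y \<in> E"
  proof cases
    case 1
    obtain N where N: "\<And>n. \<exists>g\<in>carrier (G n). conj_prods N g (G n) = carrier (G n)"
      using star unfolding star_property_def by blast
    then obtain g where gc: "\<And>n. g n \<in> carrier (G n)"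
      and g: "\<And>n. conj_prods N (g n) (G n) = carrier (G n)"
      by metis
    have gP: "g \<in> carrier P" using gc by auto
    then obtain m where m: "m \<in> wide" "cls g = cls m" using 1 hom_closed by blast
    have mP: "m \<in> carrier P" using m(1) by (simp add: wide_def)
    obtain e where e: "e \<in> E" "g = e \<otimes>\<^bsub>P\<^esub> m" using cls_eqE[OF gP mP m(2)] .
    have eP: "e \<in> carrier P" using e(1) by (simp add: met_null_def)
    \<comment> \<open>The threshold is taken for \<open>Suc N\<close>, one more than the width bound
      for \<open>g\<close>. If \<open>e n\<close> and \<open>m n\<close> both had width at least
      \<open>l\<close>, their product \<open>g n\<close> would have width above \<open>N\<close>; as
      \<open>m n\<close> is that wide at \<open>U\<close>-many indices, \<open>e n\<close> is
      not.\<close>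
    obtain l where l: "\<And>n g h. g \<in> carrier (G n) \<Longrightarrow> h \<in> carrier (G n) \<Longrightarrow>
        enat l \<le> conj_width g (G n) \<Longrightarrow> enat l \<le> conj_width h (G n) \<Longrightarrow>
        enat (Suc N) \<le> conj_width (g \<otimes>\<^bsub>G n\<^esub> h) (G n)"
      using star unfolding star_property_def by blast
    have "\<forall>\<^sub>F n in U. enat l \<le> conj_width (m n) (G n)" using m(1) by (simp add: wide_def)
    then have "\<forall>\<^sub>F n in U. conj_width (e n) (G n) < enat l"
    proof eventually_elim
      case (elim n)
      show ?case
      proof (rule ccontr)
        assume "\<not> ?thesis"
        then have "enat (Suc N) \<le> conj_width (g n) (G n)"
          using l[OF P_carrier[OF eP] P_carrier[OF mP]] elim e(2) by simp
        also have "\<dots> \<le> enat N" by (rule conj_width_le[OF g])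
        finally show False by simp
      qed
    qed
    then show ?thesis using bounded_width_null_imp_trivial[OF e(1)] yP by blast
  next
    case 2
    then have "cls y = cls \<one>\<^bsub>P\<^esub>" using y hom_one by blast
    then obtain e where "e \<in> E" "y = e \<otimes>\<^bsub>P\<^esub> \<one>\<^bsub>P\<^esub>"
      using cls_eqE[OF yP one_carrier_P] by blast
    moreover then have "e \<otimes>\<^bsub>P\<^esub> \<one>\<^bsub>P\<^esub> = e"
      by (intro G.r_one) (simp add: met_null_def)
    ultimately show ?thesis by metis
  qed
qed

section \<open>Uniform width bounds and the conclusion\<close>

text \<open>If no bound worked, then for every \<open>N\<close> there would be elements of norm
  above \<open>r\<close> and width at least \<open>N\<close> at \<open>U\<close>-many indices. A
  diagonal choice makes them into one sequence in \<open>wide\<close> whose norms exceed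
  \<open>r\<close> at \<open>U\<close>-many indices, so it is not null.\<close>

lemma eventually_uniform_width:
  assumes nonpr: "nonprincipal U" and sub: "wide \<subseteq> E" and r: "0 < r"
  shows "\<exists>N. \<forall>\<^sub>F n in U. \<forall>x\<in>carrier (G n). r < nrm n x \<longrightarrow> conj_width x (G n) < enat N"
proof (rule ccontr)
  define R where
    "R N n x \<longleftrightarrow> x \<in> carrier (G n) \<and> r < nrm n x \<and> enat N \<le> conj_width x (G n)" for N n x
  assume neg: "\<not> ?thesis"
  have ev: "\<forall>\<^sub>F n in U. \<exists>x. R N n x" for N
  proof -
    have "\<forall>\<^sub>F n in U. \<not> (\<forall>x\<in>carrier (G n). r < nrm n x \<longrightarrow> conj_width x (G n) < enat N)"
      using neg ultra unfolding ultrafilter_def by blast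
    then show ?thesis by eventually_elim (auto simp: R_def not_less)
  qed
  \<comment> \<open>The cap \<open>k \<le> n\<close> makes the greatest value exist even when a
    witness has infinite width.\<close>
  define k where "k n = (GREATEST k. k \<le> n \<and> (\<exists>x. R k n x))" for n
  \<comment> \<open>The identity is the default at indices without a witness and keeps
    \<open>y\<close> in the product.\<close>
  define y where "y n = (if \<exists>x. R (k n) n x then SOME x. R (k n) n x else \<one>\<^bsub>G n\<^esub>)" for n
  \<comment> \<open>Once \<open>N \<le> n\<close>, the value \<open>N\<close> competes for the
    maximum \<open>k n\<close>; and \<open>R\<close> is antitone in its first argument, so a witness
    for \<open>k n\<close> is one for \<open>N\<close> too.\<close>
  have Ry: "R N n (y n)" if "N \<le> n" "\<exists>x. R N n x" for N n
  proof -
    have "k n \<le> n \<and> (\<exists>x. R (k n) n x)"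
      unfolding k_def by (rule GreatestI_nat[where b = n]) (use that in auto)
    moreover have "N \<le> k n"
      unfolding k_def by (rule Greatest_le_nat[where b = n]) (use that in auto)
    ultimately have "R (k n) n (y n)" "N \<le> k n"
      unfolding y_def using someI_ex[of "R (k n) n"] by auto
    then show ?thesis unfolding R_def
      by (meson enat_ord_simps(1) order_trans)
  qed
  have evy: "\<forall>\<^sub>F n in U. R N n (y n)" for N
    using ev[of N] nonprincipal_eventually_ge[OF ultra nonpr, of N]
    by eventually_elim (rule Ry)
  have "y n \<in> carrier (G n)" for n
    using group.is_monoid[OF G_group] someI_ex[of "R (k n) n"]
    by (auto simp: y_def R_def monoid.one_closed)
  then have "y \<in> carrier P" by auto
  moreover have "\<forall>\<^sub>F n in U. enat N \<le> conj_width (y n) (G n)" for N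
    using evy[of N] by eventually_elim (simp add: R_def)
  ultimately have "y \<in> E" using sub by (auto simp: wide_def)
  then have "((\<lambda>n. nrm n (y n)) \<longlongrightarrow> 0) U" by (simp add: met_null_def)
  then have "\<forall>\<^sub>F n in U. nrm n (y n) < r" using r by (rule order_tendstoD(2))
  with evy[of 0] have "\<forall>\<^sub>F n in U. False" by eventually_elim (simp add: R_def)
  then show False using ultra by (simp add: ultrafilter_def)
qed

text \<open>The norms of a representative have a limit above \<open>r\<close>, so at
  \<open>U\<close>-many indices they exceed \<open>r\<close> and the width is below
  \<open>N\<close>. There every \<open>h n\<close> is a product of at most \<open>N\<close>
  conjugates, and \<open>cls_in_conj_prods\<close> carries this over to \<open>Q\<close>.\<close>

lemma metrically_uniformly_simple_if_simple:
  assumes star: "star_property (range G)" and nonpr: "nonprincipal U"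
    and simple: "simple_grp Q"
  shows "metrically_uniformly_simple Q (ultra_norm U nrm)"
  unfolding metrically_uniformly_simple_def
proof (intro allI impI)
  fix r t :: real assume "0 < r \<and> r < t"
  then obtain N where
    N: "\<forall>\<^sub>F n in U. \<forall>x\<in>carrier (G n). r < nrm n x \<longrightarrow> conj_width x (G n) < enat N"
    using eventually_uniform_width[OF nonpr wide_subset_null[OF star simple]] by blast
  have "Y \<in> conj_prods N X Q"
    if X: "X \<in> carrier Q" and r: "r < ultra_norm U nrm X" and Y: "Y \<in> carrier Q" for X Y
  proof -
    obtain g where g: "g \<in> carrier P" "X = cls g" using X cls_surj by blast
    obtain h where h: "h \<in> carrier P" "Y = cls h" using Y cls_surj by blast
    have "g \<in> X" using g group.rcos_self[OF P_group g(1) met_null_subgroup] by simp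
    then have "\<forall>\<^sub>F n in U. r < nrm n (g n)"
      using order_tendstoD(1)[OF tendsto_ultra_norm[OF X] r] by blast
    with N have "\<forall>\<^sub>F n in U. h n \<in> conj_prods N (g n) (G n)"
    proof eventually_elim
      case (elim n)
      then show ?case
        using group.conj_prods_eq_carrier[OF G_group P_carrier[OF g(1)]]
          P_carrier[OF g(1)] P_carrier[OF h(1)] by blast
    qed
    then show ?thesis using cls_in_conj_prods[OF g(1) h(1)] g h by simp
  qed
  then show "\<exists>N. \<forall>g\<in>carrier Q. ultra_norm U nrm g \<in> {r<..t} \<longrightarrow>
      {h \<in> carrier Q. ultra_norm U nrm h < t} \<subseteq> conj_prods N g Q"
    by (intro exI[of _ N]) auto
qed

end

theorem theorem8p12:
  fixes G :: "nat \<Rightarrow> ('a, 'b) monoid_scheme"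
    and nrm :: "nat \<Rightarrow> 'a \<Rightarrow> real"
    and U :: "nat filter"
  assumes "\<And>n. metric_group (G n) (nrm n)"
    and "\<And>n g. g \<in> carrier (G n) \<Longrightarrow> nrm n g \<le> 1"
    and "star_property (range G)"
    and "ultrafilter U" and "nonprincipal U"
    and "simple_grp (met_ultraproduct U G nrm)"
  shows "metrically_uniformly_simple (met_ultraproduct U G nrm) (ultra_norm U nrm)"
proof -
  interpret metric_group_family U G nrm
    using assms(1,2,4) by (rule metric_group_family.intro)
  show ?thesis
    using assms(3,5,6) by (rule metrically_uniformly_simple_if_simple)
qed

end
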